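(* Let $1\le r\le s$ be integers, let $G=GL_r(\mathbb{C})\times GL_s(\mathbb{C})$, and let $V=GSV(r,s)=\{(X,Y): X\in \mathrm{Mat}_{r\times s}(\mathbb{C}),\ Y\in \mathrm{Mat}_{s\times r}(\mathbb{C}),\ XY=I_{r\times r}\}$. Let $G$ act on $W=\mathrm{Mat}_{r\times s}(\mathbb{C})\oplus \mathrm{Mat}_{s\times r}(\mathbb{C})$ by $(A,B)\cdot (X,Y)=(AXB^{-1},\,BYA^{-1})$. Let $v=(X_0,Y_0)\in W$ with $$X_0=\begin{pmatrix} I_{r\times r} & 0_{r\times (s-r)}\end{pmatrix},\qquad Y_0=\begin{pmatrix} I_{r\times r}\\ 0_{(s-r)\times r}\end{pmatrix}.$$ Then $V$ is a homogeneous space of $G$, namely the orbit $V=G\cdot v$, and $v$ is not a weight vector of the representation $W$ with respect to the maximal torus $\mathbb{T}\subset G$ of pairs of diagonal matrices.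
   Context: The variety $GSV(r,s)$ is called the generalised affine Stiefel algebraic variety. A homogeneous space of $G$ is a space on which $G$ acts transitively. A weight vector of $W$ with respect to $\mathbb{T}$ is a nonzero vector $w\in W$ such that for some character $\chi:\mathbb{T}\to\mathbb{C}^*$ one has $t\cdot w=\chi(t)w$ for all $t\in\mathbb{T}$. *)

theory Defs
  imports "HOL-Algebra.Group_Action" "Jordan_Normal_Form.Matrix"
begin

definition GL :: "nat \<Rightarrow> complex mat monoid" where
  "GL n = units_of (ring_mat TYPE(complex) n ())"

abbreviation GL_pair :: "nat \<Rightarrow> nat \<Rightarrow> (complex mat \<times> complex mat) monoid" where
  "GL_pair r s \<equiv> GL r \<times>\<times> GL s"

definition mat_pairs :: "nat \<Rightarrow> nat \<Rightarrow> (complex mat \<times> complex mat) set" where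
  "mat_pairs r s = carrier_mat r s \<times> carrier_mat s r"

definition GSV :: "nat \<Rightarrow> nat \<Rightarrow> (complex mat \<times> complex mat) set" where
  "GSV r s = {(X, Y) \<in> mat_pairs r s. X * Y = 1\<^sub>m r}"

text \<open>The permutations of a set \<open>E\<close> underlying \<^locale>\<open>group_action\<close> are undefined outside of
  \<open>E\<close>, so the action on an invariant subset is the restriction of this function to that subset.\<close>

definition act ::
    "nat \<Rightarrow> nat \<Rightarrow> complex mat \<times> complex mat \<Rightarrow> complex mat \<times> complex mat
      \<Rightarrow> complex mat \<times> complex mat" where
  "act r s g = (\<lambda>w \<in> mat_pairs r s.
     (fst g * fst w * inv\<^bsub>GL s\<^esub> (snd g), snd g * snd w * inv\<^bsub>GL r\<^esub> (fst g)))"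

text \<open>The two matrices with an identity block of size \<open>r\<close>, padded with zero columns
  (respectively rows); the lower blocks of the first one have no rows.\<close>

definition base_point :: "nat \<Rightarrow> nat \<Rightarrow> complex mat \<times> complex mat" where
  "base_point r s =
     (four_block_mat (1\<^sub>m r) (0\<^sub>m r (s - r)) (0\<^sub>m 0 r) (0\<^sub>m 0 (s - r)),
      1\<^sub>m r @\<^sub>r 0\<^sub>m (s - r) r)"

definition torus :: "nat \<Rightarrow> nat \<Rightarrow> (complex mat \<times> complex mat) monoid" where
  "torus r s = (GL_pair r s)
     \<lparr>carrier := {(A, B) \<in> carrier (GL_pair r s). diagonal_mat A \<and> diagonal_mat B}\<rparr>"

definition complex_units :: "complex monoid" where
  "complex_units = \<lparr>carrier = - {0}, monoid.mult = (*), one = 1\<rparr>"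

text \<open>Characters are morphisms of algebraic groups. The coordinate ring of the torus consists of
  the Laurent polynomials in the \<open>r + s\<close> diagonal entries.\<close>

definition regular_on_torus ::
    "nat \<Rightarrow> nat \<Rightarrow> (complex mat \<times> complex mat \<Rightarrow> complex) \<Rightarrow> bool" where
  "regular_on_torus r s f \<longleftrightarrow>
     (\<exists>(S :: ((nat \<Rightarrow> int) \<times> (nat \<Rightarrow> int)) set) c. finite S \<and>
       (\<forall>(A, B) \<in> carrier (torus r s).
          f (A, B) = (\<Sum>(m, n)\<in>S. c (m, n) *
            (\<Prod>i<r. A $$ (i, i) powi m i) * (\<Prod>j<s. B $$ (j, j) powi n j))))"

definition torus_character ::
    "nat \<Rightarrow> nat \<Rightarrow> (complex mat \<times> complex mat \<Rightarrow> complex) \<Rightarrow> bool" where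
  "torus_character r s \<chi> \<longleftrightarrow>
     \<chi> \<in> hom (torus r s) complex_units \<and> regular_on_torus r s \<chi>"

definition weight_vector :: "nat \<Rightarrow> nat \<Rightarrow> complex mat \<times> complex mat \<Rightarrow> bool" where
  "weight_vector r s w \<longleftrightarrow>
     w \<in> mat_pairs r s \<and> w \<noteq> (0\<^sub>m r s, 0\<^sub>m s r) \<and>
     (\<exists>\<chi>. torus_character r s \<chi> \<and>
       (\<forall>t \<in> carrier (torus r s). act r s t w = (\<chi> t \<cdot>\<^sub>m fst w, \<chi> t \<cdot>\<^sub>m snd w)))"

end

theory Submission
  imports Defs "Jordan_Normal_Form.Determinant"
begin

text \<open>Given \<open>X Y = I\<close>, Gauss--Jordan elimination yields an invertible \<open>P\<close> with \<open>P Y = Y\<^sub>0\<close>, because a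
  row echelon form with a left inverse has a pivot in every column. With \<open>L = X P\<^sup>-\<^sup>1\<close> and
  \<open>D = X\<^sub>0 - L\<close> one has \<open>D Y\<^sub>0 = 0\<close>, so \<open>M = I + Y\<^sub>0 D\<close> is invertible with inverse \<open>I - Y\<^sub>0 D\<close>, fixes
  \<open>Y\<^sub>0\<close> and satisfies \<open>L M = X\<^sub>0\<close>. Hence \<open>(I, P\<^sup>-\<^sup>1 M)\<close> maps \<open>(X\<^sub>0, Y\<^sub>0)\<close> to \<open>(X, Y)\<close>.
  The torus element \<open>(2 I, I)\<close> scales \<open>X\<^sub>0\<close> by \<open>2\<close> and \<open>Y\<^sub>0\<close> by \<open>1/2\<close>.\<close>

section \<open>Group actions from functions, and matrix associativity\<close>

text \<open>The function of the inverse group element is a two-sided inverse on \<open>E\<close>, so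
  bijectivity follows from closure and the two action laws. The restriction provides the
  extensionality that membership in \<open>Bij E\<close> demands.\<close>

lemma group_action_restrictI:
  assumes "group G"
    and closed: "\<And>g x. g \<in> carrier G \<Longrightarrow> x \<in> E \<Longrightarrow> f g x \<in> E"
    and one: "\<And>x. x \<in> E \<Longrightarrow> f \<one>\<^bsub>G\<^esub> x = x"
    and mult: "\<And>g h x. g \<in> carrier G \<Longrightarrow> h \<in> carrier G \<Longrightarrow> x \<in> E \<Longrightarrow>
      f (g \<otimes>\<^bsub>G\<^esub> h) x = f g (f h x)"
  shows "group_action G E (\<lambda>g. restrict (f g) E)"
proof -
  interpret G: group G by fact
  have bij: "restrict (f g) E \<in> Bij E" if g: "g \<in> carrier G" for g
  proof -
    have "bij_betw (f g) E E"
    proof (rule bij_betw_byWitness)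
      show "\<forall>x\<in>E. f (inv\<^bsub>G\<^esub> g) (f g x) = x" "\<forall>x\<in>E. f g (f (inv\<^bsub>G\<^esub> g) x) = x"
        using g by (simp_all add: one flip: mult)
    qed (use g closed in auto)
    then show ?thesis by (simp add: Bij_def bij_betw_restrict_eq)
  qed
  have "restrict (f (g \<otimes>\<^bsub>G\<^esub> h)) E = compose E (restrict (f g) E) (restrict (f h) E)"
    if "g \<in> carrier G" "h \<in> carrier G" for g h
    using that by (auto simp: fun_eq_iff compose_def mult closed)
  then have "(\<lambda>g. restrict (f g) E) \<in> hom G (BijGroup E)"
    by (auto simp: hom_def BijGroup_def bij)
  then show ?thesis
    by (intro group_action.intro group_hom.intro group_hom_axioms.intro group_BijGroup \<open>group G\<close>)
qed

text \<open>Stating the side conditions through dimensions lets the simplifier discharge them for nested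
  products, where the carrier version has to guess the inner dimensions.\<close>

lemma mult_mat_assoc_dim:
  fixes A B C :: "'a :: semiring_0 mat"
  assumes "dim_col A = dim_row B" "dim_col B = dim_row C"
  shows "A * B * C = A * (B * C)"
  by (rule assoc_mult_mat[of A "dim_row A" "dim_row B" B "dim_row C" C "dim_col C"])
    (use assms in auto)

section \<open>General linear groups\<close>

lemma group_GL: "group (GL n)"
proof -
  interpret ring "ring_mat TYPE(complex) n ()" by (rule ring_mat)
  show ?thesis unfolding GL_def by (rule units_group)
qed

lemma group_GL_pair: "group (GL_pair r s)"
  by (intro DirProd_group group_GL)

lemma mult_GL [simp]: "A \<otimes>\<^bsub>GL n\<^esub> B = A * B"
  by (simp add: GL_def units_of_mult ring_mat_simps)

lemma one_GL [simp]: "\<one>\<^bsub>GL n\<^esub> = 1\<^sub>m n"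
  by (simp add: GL_def units_of_one ring_mat_simps)

lemma GL_iff:
  "A \<in> carrier (GL n) \<longleftrightarrow>
    A \<in> carrier_mat n n \<and> (\<exists>B \<in> carrier_mat n n. B * A = 1\<^sub>m n \<and> A * B = 1\<^sub>m n)"
  by (auto simp: GL_def units_of_carrier Units_def ring_mat_simps)

lemma GL_carrier_mat: "A \<in> carrier (GL n) \<Longrightarrow> A \<in> carrier_mat n n"
  by (simp add: GL_iff)

text \<open>An explicit two-sided inverse settles both membership and the value of
  \<open>inv\<close>; all concrete inverses below are computed this way.\<close>

lemma GL_I:
  assumes "A \<in> carrier_mat n n" "B \<in> carrier_mat n n" "B * A = 1\<^sub>m n" "A * B = 1\<^sub>m n"
  shows "A \<in> carrier (GL n)" "B \<in> carrier (GL n)" "inv\<^bsub>GL n\<^esub> A = B"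
proof -
  show A: "A \<in> carrier (GL n)" and B: "B \<in> carrier (GL n)"
    using assms by (auto simp: GL_iff)
  show "inv\<^bsub>GL n\<^esub> A = B"
    using group.inv_equality[OF group_GL, where x = A and y = B] A B assms by simp
qed

lemma
  assumes "A \<in> carrier (GL n)"
  shows GL_inv_carrier_mat: "inv\<^bsub>GL n\<^esub> A \<in> carrier_mat n n"
    and GL_l_inv: "inv\<^bsub>GL n\<^esub> A * A = 1\<^sub>m n"
    and GL_r_inv: "A * inv\<^bsub>GL n\<^esub> A = 1\<^sub>m n"
  using group.inv_closed[OF group_GL assms] group.l_inv[OF group_GL assms]
    group.r_inv[OF group_GL assms] by (simp_all add: GL_carrier_mat)

section \<open>The action and its invariant set\<close>

text \<open>In the product of the two new components the inner factors \<open>B' * B\<close> cancel,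
  which leaves the conjugate of \<open>X * Y = 1\<close> by \<open>A\<close>.\<close>

lemma act_closed:
  assumes g: "g \<in> carrier (GL_pair r s)" and w: "w \<in> GSV r s"
  shows "act r s g w \<in> GSV r s"
proof -
  obtain A B X Y where [simp]: "g = (A, B)" "w = (X, Y)" by fastforce
  define A' B' where A'_def: "A' = inv\<^bsub>GL r\<^esub> A" and B'_def: "B' = inv\<^bsub>GL s\<^esub> B"
  have c: "A \<in> carrier_mat r r" "A' \<in> carrier_mat r r" "B \<in> carrier_mat s s"
      "B' \<in> carrier_mat s s" "X \<in> carrier_mat r s" "Y \<in> carrier_mat s r"
    and XY: "X * Y = 1\<^sub>m r"
    using g w by (auto simp: A'_def B'_def GL_carrier_mat GL_inv_carrier_mat GSV_def mat_pairs_def)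
  have inv: "B' * B = 1\<^sub>m s" "A * A' = 1\<^sub>m r"
    using g by (auto simp: A'_def B'_def GL_l_inv GL_r_inv)
  have "A * X * B' * (B * Y * A') = A * (X * ((B' * B) * Y)) * A'"
    using c by (simp add: mult_mat_assoc_dim)
  also have "\<dots> = 1\<^sub>m r"
    using c by (simp add: inv XY)
  finally show ?thesis
    using c by (auto simp: act_def GSV_def mat_pairs_def simp flip: A'_def B'_def)
qed

lemma act_one: "w \<in> mat_pairs r s \<Longrightarrow> act r s \<one>\<^bsub>GL_pair r s\<^esub> w = w"
  using GL_I(3)[of "1\<^sub>m r" r "1\<^sub>m r"] GL_I(3)[of "1\<^sub>m s" s "1\<^sub>m s"]
  by (auto simp: act_def mat_pairs_def)

text \<open>Inversion reverses products, so in each component both sides are the same word up to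
  bracketing.\<close>

lemma act_mult:
  assumes g: "g \<in> carrier (GL_pair r s)" and h: "h \<in> carrier (GL_pair r s)"
    and w: "w \<in> mat_pairs r s"
  shows "act r s (g \<otimes>\<^bsub>GL_pair r s\<^esub> h) w = act r s g (act r s h w)"
proof -
  obtain A B A1 B1 X Y where [simp]: "g = (A, B)" "h = (A1, B1)" "w = (X, Y)" by fastforce
  define A' B' A1' B1' where defs: "A' = inv\<^bsub>GL r\<^esub> A" "B' = inv\<^bsub>GL s\<^esub> B"
    "A1' = inv\<^bsub>GL r\<^esub> A1" "B1' = inv\<^bsub>GL s\<^esub> B1"
  have c: "A \<in> carrier_mat r r" "A' \<in> carrier_mat r r" "B \<in> carrier_mat s s"
      "B' \<in> carrier_mat s s" "X \<in> carrier_mat r s" "Y \<in> carrier_mat s r"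
      "A1 \<in> carrier_mat r r" "A1' \<in> carrier_mat r r" "B1 \<in> carrier_mat s s"
      "B1' \<in> carrier_mat s s"
    using g h w by (auto simp: defs GL_carrier_mat GL_inv_carrier_mat mat_pairs_def)
  have inv: "inv\<^bsub>GL r\<^esub> (A * A1) = A1' * A'" "inv\<^bsub>GL s\<^esub> (B * B1) = B1' * B'"
    using group.inv_mult_group[OF group_GL, where x = A and y = A1] group.inv_mult_group[OF group_GL, where x = B and y = B1]
      g h by (auto simp: defs)
  show ?thesis
    using c by (simp add: act_def mat_pairs_def inv mult_mat_assoc_dim flip: defs)
qed

section \<open>Row echelon forms with a left inverse\<close>

text \<open>A left inverse rules out a column without a pivot, so the pivots sit exactly on the
  diagonal. The argument compares entries of \<open>L * C\<close> directly and therefore works over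
  any \<open>semiring_1\<close>, without a notion of rank.\<close>

lemma row_echelon_form_left_inverse:
  fixes C L :: "'a :: semiring_1 mat"
  assumes C: "C \<in> carrier_mat s r" "row_echelon_form C"
    and L: "L \<in> carrier_mat r s" and LC: "L * C = 1\<^sub>m r"
    and i: "i < s" and j: "j < r"
  shows "C $$ (i, j) = (if i = j then 1 else 0)"
proof -
  obtain f where f: "pivot_fun C f r"
    using C by (auto simp: row_echelon_form_def)
  note piv = pivot_funD[OF carrier_matD(1)[OF C(1)] f]
  have entry: "(\<Sum>l<s. L $$ (i, l) * C $$ (l, j)) = (if i = j then 1 else 0)"
    if "i < r" "j < r" for i j
    using arg_cong[OF LC, of "\<lambda>M. M $$ (i, j)"] that C(1) L
    by (simp add: scalar_prod_def lessThan_atLeast0)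
  have pivot: "k < s \<and> f k = k" if "k < r" for k
    using that
  proof (induction k rule: less_induct)
    case (less k)
    have IH: "l < s" "f l = l" if "l < k" for l
      using less that by auto
    have unit: "C $$ (i, l) = (if i = l then 1 else 0)" if "l < k" "i < s" for i l
      using piv(4,5)[of l] IH[OF that(1)] that less.prems by auto
    show ?case
    proof (rule ccontr)
      assume no_pivot: "\<not> ?case"
      \<comment> \<open>Pivot positions increase strictly until they reach \<open>r\<close>, the
        value that marks a zero row. As \<open>k < r\<close>, neither case allows a return to column
        \<open>k\<close>. If \<open>k\<close> is not a row index, the claim is vacuous.\<close>
      have gt: "k < f (k + d)" if "k + d < s" for d
        using that
      proof (induction d)
        case 0
        have "k \<le> f k"
        proof (cases k)
          case (Suc m)
          then show ?thesis using piv(3)[of m] IH[of m] 0 less.prems by auto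
        qed simp
        then show ?case using no_pivot 0 by auto
      next
        case (Suc d)
        then show ?case using piv(3)[of "k + d"] less.prems by auto
      qed
      have zero: "C $$ (l, k) = 0" if "k \<le> l" "l < s" for l
        using gt[of "l - k"] piv(2)[of l k] that by simp
      \<comment> \<open>Column \<open>l\<close> of \<open>C\<close> is already the
        \<open>l\<close>-th unit vector, so the entry of \<open>L * C\<close> at
        \<open>(k, l)\<close>, which is 0, equals that of \<open>L\<close>.\<close>
      have L0: "L $$ (k, l) = 0" if "l < k" for l
      proof -
        have "0 = (\<Sum>m<s. L $$ (k, m) * C $$ (m, l))"
          using entry[of k l] that less.prems by simp
        also have "\<dots> = (\<Sum>m<s. if m = l then L $$ (k, l) else 0)"
          by (rule sum.cong) (auto simp: unit[OF that])
        also have "\<dots> = L $$ (k, l)"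
          using IH[OF that] by simp
        finally show ?thesis by simp
      qed
      \<comment> \<open>Every summand of the diagonal entry \<open>(k, k)\<close> of
        \<open>L * C\<close> vanishes: the left factor for \<open>l < k\<close>, the right factor
        otherwise. That entry should be 1.\<close>
      have "L $$ (k, l) * C $$ (l, k) = 0" if "l < s" for l
        using zero[of l] L0[of l] that by (cases "l < k") auto
      then show False
        using entry[of k k] less.prems by simp
    qed
  qed
  show ?thesis
    using piv(4,5)[of j] pivot[OF j] i j by auto
qed

section \<open>The base point\<close>

text \<open>Both block forms become the same Kronecker delta, which is the shape that the row
  echelon lemma delivers. The assumption \<open>r \<le> s\<close> makes \<open>r + (s - r)\<close>
  equal to \<open>s\<close> under truncated subtraction.\<close>

lemma
  assumes "r \<le> s"
  shows fst_base_point_carrier: "fst (base_point r s) \<in> carrier_mat r s"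
    and snd_base_point_carrier: "snd (base_point r s) \<in> carrier_mat s r"
    and fst_base_point_index: "\<And>i j. i < r \<Longrightarrow> j < s \<Longrightarrow>
      fst (base_point r s) $$ (i, j) = (if i = j then 1 else 0)"
    and snd_base_point_index: "\<And>i j. i < s \<Longrightarrow> j < r \<Longrightarrow>
      snd (base_point r s) $$ (i, j) = (if i = j then 1 else 0)"
  using assms by (auto simp: base_point_def append_rows_def)

lemma base_point_mult:
  assumes "r \<le> s"
  shows "fst (base_point r s) * snd (base_point r s) = 1\<^sub>m r"
proof (rule eq_matI)
  fix i j assume "i < dim_row (1\<^sub>m r :: complex mat)" "j < dim_col (1\<^sub>m r :: complex mat)"
  then have ij: "i < r" "j < r" by auto
  have "(fst (base_point r s) * snd (base_point r s)) $$ (i, j) =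
      (\<Sum>l<s. (if i = l then 1 else 0) * (if l = j then 1 else 0))"
    using ij fst_base_point_carrier[OF assms] snd_base_point_carrier[OF assms]
    by (auto simp: scalar_prod_def lessThan_atLeast0 fst_base_point_index[OF assms]
        snd_base_point_index[OF assms] simp del: sum.delta intro!: sum.cong)
  also have "\<dots> = (\<Sum>l<s. if l = i then (if i = j then 1 else 0) else 0)"
    by (rule sum.cong) auto
  also have "\<dots> = 1\<^sub>m r $$ (i, j)"
    using ij assms by simp
  finally show "(fst (base_point r s) * snd (base_point r s)) $$ (i, j) = 1\<^sub>m r $$ (i, j)" .
qed (use fst_base_point_carrier[OF assms] snd_base_point_carrier[OF assms] in auto)

lemma base_point_in_GSV: "r \<le> s \<Longrightarrow> base_point r s \<in> GSV r s"
  using fst_base_point_carrier[of r s] snd_base_point_carrier[of r s] base_point_mult[of r s]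
  by (cases "base_point r s") (simp add: GSV_def mat_pairs_def)

section \<open>Transitivity\<close>

text \<open>The difference \<open>D\<close> of the two left inverses kills \<open>Y\<close>, so
  \<open>Y * D\<close> squares to zero and \<open>1 + Y * D\<close> is unipotent. It adds
  \<open>X * Y * D = D\<close> to \<open>X\<close>. This corrects the first component of a pair once
  the second is normalised.\<close>

lemma invertible_between_left_inverses:
  fixes X X' :: "'a :: field mat"
  assumes X: "X \<in> carrier_mat r s" and X': "X' \<in> carrier_mat r s" and Y: "Y \<in> carrier_mat s r"
    and XY: "X * Y = 1\<^sub>m r" and X'Y: "X' * Y = 1\<^sub>m r"
  obtains M N where "M \<in> carrier_mat s s" "N \<in> carrier_mat s s" "M * N = 1\<^sub>m s" "N * M = 1\<^sub>m s"
    "X * M = X'" "M * Y = Y"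
proof -
  define D where "D = X' - X"
  have D: "D \<in> carrier_mat r s" unfolding D_def using X by (rule minus_carrier_mat)
  have DY: "D * Y = 0\<^sub>m r r"
    using X X' Y by (simp add: D_def minus_mult_distrib_mat XY X'Y)
  have YD: "Y * D \<in> carrier_mat s s" using Y D by simp
  have "Y * D * (Y * D) = Y * ((D * Y) * D)"
    using Y D by (simp add: mult_mat_assoc_dim)
  then have nil: "Y * D * (Y * D) = 0\<^sub>m s s"
    using Y D by (simp add: DY)
  have one: "1\<^sub>m s \<in> carrier_mat s s" by simp
  have plus: "1\<^sub>m s + Y * D \<in> carrier_mat s s" and minus: "1\<^sub>m s - Y * D \<in> carrier_mat s s"
    using YD by (auto intro: minus_carrier_mat)
  have "(1\<^sub>m s + Y * D) * (1\<^sub>m s - Y * D) = (1\<^sub>m s + Y * D) - (Y * D + Y * D * (Y * D))"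
    using mult_minus_distrib_mat[OF plus one YD] add_mult_distrib_mat[OF one YD YD]
      right_mult_one_mat[OF plus] left_mult_one_mat[OF YD] by simp
  also have "\<dots> = 1\<^sub>m s"
    unfolding nil using YD Y D by (auto intro!: eq_matI)
  finally have "(1\<^sub>m s + Y * D) * (1\<^sub>m s - Y * D) = 1\<^sub>m s" .
  moreover have "(1\<^sub>m s - Y * D) * (1\<^sub>m s + Y * D) = 1\<^sub>m s"
    by (rule mat_mult_left_right_inverse[OF plus minus calculation])
  moreover have "X * (1\<^sub>m s + Y * D) = X'"
  proof -
    have "X * (1\<^sub>m s + Y * D) = X + (X * Y) * D"
      using mult_add_distrib_mat[OF X one YD] right_mult_one_mat[OF X] X Y D
      by (simp add: mult_mat_assoc_dim)
    also have "\<dots> = X'"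
      using X X' D unfolding XY by (auto simp: D_def intro!: eq_matI)
    finally show ?thesis .
  qed
  moreover have "(1\<^sub>m s + Y * D) * Y = Y"
    using add_mult_distrib_mat[OF one YD Y] left_mult_one_mat[OF Y] Y D
    by (simp add: mult_mat_assoc_dim DY)
  ultimately show thesis
    by (intro that[OF plus minus])
qed

text \<open>The factor \<open>GL s\<close> alone already reaches every point: elimination normalises
  \<open>Y\<close>, then a matrix fixing \<open>Y0\<close> normalises the first component.\<close>

lemma GSV_obtain_act_base_point:
  assumes "r \<le> s" and w: "w \<in> GSV r s"
  obtains g where "g \<in> carrier (GL_pair r s)" "act r s g (base_point r s) = w"
proof -
  obtain X Y where [simp]: "w = (X, Y)" by fastforce
  have X: "X \<in> carrier_mat r s" and Y: "Y \<in> carrier_mat s r" and XY: "X * Y = 1\<^sub>m r"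
    using w by (auto simp: GSV_def mat_pairs_def)
  obtain X0 Y0 where v: "base_point r s = (X0, Y0)" by fastforce
  have X0: "X0 \<in> carrier_mat r s" and Y0: "Y0 \<in> carrier_mat s r" and XY0: "X0 * Y0 = 1\<^sub>m r"
    and index_Y0: "\<And>i j. i < s \<Longrightarrow> j < r \<Longrightarrow> Y0 $$ (i, j) = (if i = j then 1 else 0)"
    using fst_base_point_carrier[OF \<open>r \<le> s\<close>] snd_base_point_carrier[OF \<open>r \<le> s\<close>]
      base_point_mult[OF \<open>r \<le> s\<close>] snd_base_point_index[OF \<open>r \<le> s\<close>] by (auto simp: v)
  note gj = gauss_jordan_single[OF Y refl]
  obtain P Q where P: "P \<in> carrier_mat s s" and Q: "Q \<in> carrier_mat s s"
    and PQ: "P * Q = 1\<^sub>m s" and QP: "Q * P = 1\<^sub>m s" and PY: "gauss_jordan_single Y = P * Y"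
    using gj(4) by blast
  \<comment> \<open>\<open>X * Q\<close> is a left inverse of the reduced matrix
    \<open>P * Y\<close>, as the row echelon lemma requires.\<close>
  have "X * Q * (P * Y) = X * ((Q * P) * Y)"
    using X Y P Q by (simp add: mult_mat_assoc_dim)
  then have L: "X * Q * (P * Y) = 1\<^sub>m r"
    using Y by (simp add: QP XY)
  have PY0: "P * Y = Y0"
    using row_echelon_form_left_inverse[OF gj(2,3), of "X * Q"] L X Q P Y Y0
    by (intro eq_matI) (auto simp: PY index_Y0)
  obtain M N where M: "M \<in> carrier_mat s s" and N: "N \<in> carrier_mat s s"
    and MN: "M * N = 1\<^sub>m s" and NM: "N * M = 1\<^sub>m s"
    and LM: "X * Q * M = X0" and MY0: "M * Y0 = Y0"
    using invertible_between_left_inverses[OF mult_carrier_mat[OF X Q] X0 Y0 L[unfolded PY0] XY0] .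
  have "Q * M * (N * P) = Q * ((M * N) * P)" "N * P * (Q * M) = N * ((P * Q) * M)"
    using M N P Q by (simp_all add: mult_mat_assoc_dim)
  then have inv: "Q * M * (N * P) = 1\<^sub>m s" "N * P * (Q * M) = 1\<^sub>m s"
    using P M by (simp_all add: MN PQ QP NM)
  note B = GL_I[OF mult_carrier_mat[OF Q M] mult_carrier_mat[OF N P] inv(2,1)]
  have one: "1\<^sub>m r \<in> carrier (GL r)" "inv\<^bsub>GL r\<^esub> (1\<^sub>m r) = 1\<^sub>m r"
    using GL_I[of "1\<^sub>m r" r "1\<^sub>m r"] by auto
  \<comment> \<open>\<open>N * P\<close> is the inverse of \<open>Q * M\<close>, hence the right
    factor by which the action changes \<open>X0\<close>.\<close>
  have "X0 * (N * P) = X * (Q * M * (N * P))"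
    unfolding LM[symmetric] using X M N P Q by (simp add: mult_mat_assoc_dim)
  then have X_eq: "X0 * (N * P) = X"
    using X by (simp add: inv)
  have "Q * M * Y0 = Q * (M * Y0)"
    using Q M Y0 by (simp add: mult_mat_assoc_dim)
  also have "\<dots> = (Q * P) * Y"
    unfolding MY0 unfolding PY0[symmetric] using Q P Y by (simp add: mult_mat_assoc_dim)
  finally have Y_eq: "Q * M * Y0 = Y"
    using Y by (simp add: QP)
  show thesis
  proof
    show "(1\<^sub>m r, Q * M) \<in> carrier (GL_pair r s)"
      using one B by simp
    show "act r s (1\<^sub>m r, Q * M) (base_point r s) = w"
      using X0 Y0 Q M Y_eq X_eq right_mult_one_mat[OF Y]
      by (simp add: v act_def mat_pairs_def one B)
  qed
qed

lemma transitive_action_GSV: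
  assumes "r \<le> s"
  shows "transitive_action (GL_pair r s) (GSV r s) (\<lambda>g. restrict (act r s g) (GSV r s))"
proof (rule transitive_action.intro)
  let ?G = "GL_pair r s"
  interpret group ?G by (rule group_GL_pair)
  have sub: "w \<in> mat_pairs r s" if "w \<in> GSV r s" for w
    using that by (auto simp: GSV_def)
  show "group_action ?G (GSV r s) (\<lambda>g. restrict (act r s g) (GSV r s))"
    by (rule group_action_restrictI) (auto intro: group_GL_pair act_closed act_one act_mult sub
        simp del: carrier_DirProd one_DirProd)
  show "transitive_action_axioms ?G (GSV r s) (\<lambda>g. restrict (act r s g) (GSV r s))"
  proof
    fix x y assume x: "x \<in> GSV r s" and y: "y \<in> GSV r s"
    obtain g where g: "g \<in> carrier ?G" "act r s g (base_point r s) = x"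
      using GSV_obtain_act_base_point[OF assms x] .
    obtain h where h: "h \<in> carrier ?G" "act r s h (base_point r s) = y"
      using GSV_obtain_act_base_point[OF assms y] .
    have v: "base_point r s \<in> mat_pairs r s"
      by (rule sub[OF base_point_in_GSV[OF assms]])
    \<comment> \<open>The path from \<open>x\<close> to \<open>y\<close> leads through the base
      point: back along \<open>g\<close>, then forward along \<open>h\<close>.\<close>
    have "act r s (h \<otimes>\<^bsub>?G\<^esub> inv\<^bsub>?G\<^esub> g) x = act r s (h \<otimes>\<^bsub>?G\<^esub> inv\<^bsub>?G\<^esub> g \<otimes>\<^bsub>?G\<^esub> g) (base_point r s)"
      unfolding g(2)[symmetric] by (intro act_mult[symmetric] m_closed inv_closed g h v)
    also have "\<dots> = y"
      using g(1) h by (simp add: m_assoc del: carrier_DirProd mult_DirProd one_DirProd inv_DirProd)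
    finally show "\<exists>g\<in>carrier ?G. restrict (act r s g) (GSV r s) x = y"
      using x by (intro bexI[of _ "h \<otimes>\<^bsub>?G\<^esub> inv\<^bsub>?G\<^esub> g"]) (auto intro: m_closed inv_closed g h
          simp del: carrier_DirProd)
  qed
qed

section \<open>The base point is not a weight vector\<close>

lemma base_point_not_weight_vector:
  assumes "1 \<le> r" and "r \<le> s"
  shows "\<not> weight_vector r s (base_point r s)"
proof
  assume "weight_vector r s (base_point r s)"
  then obtain \<chi> where \<chi>: "\<And>t. t \<in> carrier (torus r s) \<Longrightarrow> act r s t (base_point r s) =
      (\<chi> t \<cdot>\<^sub>m fst (base_point r s), \<chi> t \<cdot>\<^sub>m snd (base_point r s))"
    by (auto simp: weight_vector_def)
  \<comment> \<open>A scalar matrix acts on the two summands by mutually inverse factors, and 2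
    differs from its inverse.\<close>
  let ?A = "2 \<cdot>\<^sub>m 1\<^sub>m r :: complex mat"
  let ?t = "(?A, 1\<^sub>m s :: complex mat)"
  obtain X0 Y0 where v: "base_point r s = (X0, Y0)" by fastforce
  \<comment> \<open>Position \<open>(0, 0)\<close> exists because \<open>1 \<le> r\<close>. The
    entry 1 there reads off the scalar in each component.\<close>
  have X0: "X0 \<in> carrier_mat r s" "X0 $$ (0, 0) = 1" and Y0: "Y0 \<in> carrier_mat s r" "Y0 $$ (0, 0) = 1"
    using fst_base_point_carrier[of r s] snd_base_point_carrier[of r s]
      fst_base_point_index[of r s 0 0] snd_base_point_index[of r s 0 0] assms by (auto simp: v)
  have "(1/2) \<cdot>\<^sub>m 1\<^sub>m r * ?A = 1\<^sub>m r" "?A * ((1/2) \<cdot>\<^sub>m 1\<^sub>m r) = 1\<^sub>m r"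
    by (auto intro!: eq_matI)
  then have A: "?A \<in> carrier (GL r)" "inv\<^bsub>GL r\<^esub> ?A = (1/2) \<cdot>\<^sub>m 1\<^sub>m r"
    using GL_I[of ?A r "(1/2) \<cdot>\<^sub>m 1\<^sub>m r"] by auto
  have B: "1\<^sub>m s \<in> carrier (GL s)" "inv\<^bsub>GL s\<^esub> (1\<^sub>m s) = 1\<^sub>m s"
    using GL_I[of "1\<^sub>m s" s "1\<^sub>m s"] by auto
  have t: "?t \<in> carrier (torus r s)"
    using A B by (auto simp: torus_def diagonal_mat_def)
  have "act r s ?t (X0, Y0) = (2 \<cdot>\<^sub>m X0, (1/2) \<cdot>\<^sub>m Y0)"
    using X0 Y0 mult_smult_assoc_mat[of "1\<^sub>m r" r r X0 s 2] mult_smult_distrib[of Y0 s r "1\<^sub>m r" r "1/2"]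
    by (simp add: act_def mat_pairs_def A B)
  then have "2 \<cdot>\<^sub>m X0 = \<chi> ?t \<cdot>\<^sub>m X0" "(1/2) \<cdot>\<^sub>m Y0 = \<chi> ?t \<cdot>\<^sub>m Y0"
    using \<chi>[OF t] by (auto simp: v)
  then have "(2 \<cdot>\<^sub>m X0) $$ (0, 0) = (\<chi> ?t \<cdot>\<^sub>m X0) $$ (0, 0)"
      "((1/2) \<cdot>\<^sub>m Y0) $$ (0, 0) = (\<chi> ?t \<cdot>\<^sub>m Y0) $$ (0, 0)"
    by simp_all
  then show False
    using X0 Y0 assms by auto
qed

theorem mainTheorem1:
  fixes r s :: nat
  assumes "1 \<le> r" and "r \<le> s"
  shows "transitive_action (GL_pair r s) (GSV r s) (\<lambda>g. restrict (act r s g) (GSV r s))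
    \<and> orbit (GL_pair r s) (act r s) (base_point r s) = GSV r s
    \<and> \<not> weight_vector r s (base_point r s)"
proof (intro conjI)
  show "orbit (GL_pair r s) (act r s) (base_point r s) = GSV r s"
    \<comment> \<open>One inclusion is the invariance of \<open>GSV r s\<close>, the other the
      reachability of each of its points from the base point.\<close>
    using act_closed[OF _ base_point_in_GSV[OF assms(2)]] GSV_obtain_act_base_point[OF assms(2)]
    unfolding orbit_def by blast
qed (use transitive_action_GSV base_point_not_weight_vector assms in auto)

end
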